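(* Let $A$ be a finite-dimensional real associative algebra with unit such that $S=\{a\in A:a^2=-1\}$ is compact and connected, let $\mathcal U\subseteq\mathbb C$ be an open domain invariant under complex conjugation, and $V=\pi(\mathcal U\times S)$. Fix $\phi\in\mathrm{Aut}(S)$ and let $f:V\to A$ be a slice function, of class $C^1$, of the form $$f(\pi(z,s))=\alpha(z)+\phi(s)\beta(z),\qquad (z,s)\in\mathcal U\times S,$$ with $\alpha,\beta:\mathcal U\to A$, $\alpha(\bar z)=\alpha(z)$, $\beta(\bar z)=-\beta(z)$. For $a=\pi(z,s)\in V\setminus\mathbb R$, with $z=x+iy$, define $$\mathcal D_\phi f(a):=\frac{\partial f}{\partial x}(a)+\phi(s)\frac{\partial f}{\partial y}(a),$$ where $\partial_x,\partial_y$ denote the derivatives along the slice $\mathbb C_s=\{x+sy:x,y\in\mathbb R\}$ in the coordinates $z=x+iy$. Then $f$ is a generalized slice-regular function of the third class with angular part $\phi$ if and only if $\mathcal D_\phi f=0$ on $V\setminus\mathbb R$. For $\phi=\mathrm{id}_S$ the operator $\mathcal D_\phi$ reduces to the slice Cauchy–Riemann operator $\partial_x+L_s\partial_y$ (with $L_s$ left multiplication by $s$), and one recovers the classical definition of slice regularity.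
   Context: $S$ is a complex manifold with $T_sS=\{h\in A:sh+hs=0\}$ and complex structure $J_S(h)=sh$; $\mathrm{Aut}(S)$ is its group of holomorphic automorphisms. $\mathbb C\otimes A$ is over $\mathbb R$. Two maps are denoted $\pi$: $\pi(x+iy,s)=x+sy$ on $\mathbb C\times S$, and $\pi(1\otimes a+i\otimes b,s)=a+sb$ on $\mathbb C\otimes A\times S$. Involutions: $\sigma(z,s)=(\bar z,-s)$ on $\mathbb C\times S$; $\tau(z\otimes a,s)=(\bar z\otimes a,-s)$ on $\mathbb C\otimes A\times S$, extended $\mathbb R$-linearly in the first component. A function $f:V\to A$ is generalized slice-regular if there is a holomorphic map $\mathfrak F:\mathcal U\times S\to\mathbb C\otimes A\times S$ with $f\circ\pi=\pi\circ\mathfrak F$ and $\mathfrak F\circ\sigma=\tau\circ\mathfrak F$. It is of the third class with angular part $\phi$ if $\mathfrak F$ can be taken of the form $\mathfrak F(z,s)=(F(z),\phi(s))$ with $F:\mathcal U\to\mathbb C\otimes A$ holomorphic. Classical slice regularity means $f(\pi(z,s))=\pi(F(z),s)$ with $F:\mathcal U\to\mathbb C\otimes A$ holomorphic and $F(\bar z)=\overline{F(z)}$.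
   Formalization: The formal statement also assumes φ(−s) = −φ(s) on S (as part of f being a slice function); without it D_φ f(a) depends on the choice of (z,s), and f = 1 with a non-odd φ in Aut(S) for the quaternions satisfies D_φ f = 0 but is not of the third class with angular part φ. *)

theory Defs
  imports "HOL-Analysis.Analysis"
begin

text \<open>
  A finite-dimensional real associative unital algebra is a type of sort
  \<open>{real_algebra_1, euclidean_space}\<close>: \<open>euclidean_space\<close> provides finite dimension and the
  canonical topology. No compatibility between norm and multiplication is imposed, so by choosing
  any inner product every nonzero such algebra is an instance.

  \<open>\<complex> \<otimes> A\<close> over the reals is represented by \<open>'a \<times> 'a\<close>, the pair \<open>(a, b)\<close> standing for
  \<open>1 \<otimes> a + i \<otimes> b\<close>.
\<close>

text \<open>
  A complex manifold lying in a real normed space: its points, its tangent spaces and the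
  complex structure on each tangent space. A map is holomorphic if it is differentiable at every
  point with complex linear differential. The derivative along \<open>points M\<close> is determined only on
  tangent vectors, whence the restriction to \<open>tangent M p\<close>.
\<close>

record 'v complex_mfd =
  points :: "'v set"
  tangent :: "'v \<Rightarrow> 'v set"
  cstr :: "'v \<Rightarrow> 'v \<Rightarrow> 'v"

definition holomorphic_map ::
  "'v::real_normed_vector complex_mfd \<Rightarrow> 'w::real_normed_vector complex_mfd \<Rightarrow> ('v \<Rightarrow> 'w) \<Rightarrow> bool"
  where "holomorphic_map M N g \<longleftrightarrow>
    g ` points M \<subseteq> points N \<and>
    (\<forall>p\<in>points M. \<exists>D. (g has_derivative D) (at p within points M) \<and>
       (\<forall>v\<in>tangent M p. D (cstr M p v) = cstr N (g p) (D v)))"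

definition prod_mfd :: "'v complex_mfd \<Rightarrow> 'w complex_mfd \<Rightarrow> ('v \<times> 'w) complex_mfd"
    (infixr \<open>\<times>\<^sub>m\<close> 80)
  where "M \<times>\<^sub>m N =
    \<lparr>points = points M \<times> points N,
     tangent = (\<lambda>(p, q). tangent M p \<times> tangent N q),
     cstr = (\<lambda>(p, q) (v, w). (cstr M p v, cstr N q w))\<rparr>"

definition plane_mfd :: "complex set \<Rightarrow> complex complex_mfd"
  where "plane_mfd U = \<lparr>points = U, tangent = (\<lambda>_. UNIV), cstr = (\<lambda>_ v. \<i> * v)\<rparr>"

definition complexification_mfd :: "('a::real_vector \<times> 'a) complex_mfd"
  where "complexification_mfd =
    \<lparr>points = UNIV, tangent = (\<lambda>_. UNIV), cstr = (\<lambda>_ (a, b). (- b, a))\<rparr>"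

definition imag_units :: "'a::ring_1 set"
  where "imag_units = {a. a\<^sup>2 = - 1}"

definition imag_units_mfd :: "'a::ring_1 complex_mfd"
  where "imag_units_mfd =
    \<lparr>points = imag_units, tangent = (\<lambda>s. {h. s * h + h * s = 0}), cstr = (\<lambda>s h. s * h)\<rparr>"

definition Aut_imag_units :: "('a::{real_algebra_1, euclidean_space} \<Rightarrow> 'a) set"
  where "Aut_imag_units = {\<phi>. bij_betw \<phi> imag_units imag_units \<and>
    holomorphic_map imag_units_mfd imag_units_mfd \<phi> \<and>
    holomorphic_map imag_units_mfd imag_units_mfd (inv_into imag_units \<phi>)}"

definition slice_pt :: "complex \<times> 'a \<Rightarrow> 'a::real_algebra_1"
  where "slice_pt = (\<lambda>(z, s). of_real (Re z) + s * of_real (Im z))"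

definition slice_val :: "('a \<times> 'a) \<times> 'a \<Rightarrow> 'a::real_algebra_1"
  where "slice_val = (\<lambda>((a, b), s). a + s * b)"

definition slice_sigma :: "complex \<times> 'a \<Rightarrow> complex \<times> 'a::real_algebra_1"
  where "slice_sigma = (\<lambda>(z, s). (cnj z, - s))"

definition conj_cplx :: "'a \<times> 'a \<Rightarrow> 'a \<times> 'a::real_vector"
  where "conj_cplx = (\<lambda>(a, b). (a, - b))"

definition slice_tau :: "('a \<times> 'a) \<times> 'a \<Rightarrow> ('a \<times> 'a) \<times> 'a::real_algebra_1"
  where "slice_tau = (\<lambda>(w, s). (conj_cplx w, - s))"

text \<open>
  Functions on \<open>V = slice_pt ` (U \<times> imag_units)\<close> are total functions of which only the values
  on \<open>V\<close> matter. An equivariant lift of \<open>f\<close>, holomorphic or not, makes \<open>f\<close> a slice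
  function. For a lift of the form \<open>(z, s) \<mapsto> (F z, \<phi> s)\<close> and nonempty \<open>U\<close>, equivariance
  includes \<open>\<phi> (- s) = - \<phi> s\<close>. This is not automatic for automorphisms of the manifold of
  imaginary units.
\<close>

definition slice_lift ::
  "complex set \<Rightarrow> ('a \<Rightarrow> 'a::real_algebra_1) \<Rightarrow> (complex \<times> 'a \<Rightarrow> ('a \<times> 'a) \<times> 'a) \<Rightarrow> bool"
  where "slice_lift U f FF \<longleftrightarrow>
    (\<forall>p\<in>U \<times> imag_units. f (slice_pt p) = slice_val (FF p) \<and>
       FF (slice_sigma p) = slice_tau (FF p))"

definition regular_lift ::
  "complex set \<Rightarrow> ('a \<Rightarrow> 'a::{real_algebra_1, euclidean_space}) \<Rightarrow>
   (complex \<times> 'a \<Rightarrow> ('a \<times> 'a) \<times> 'a) \<Rightarrow> bool"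
  where "regular_lift U f FF \<longleftrightarrow> slice_lift U f FF \<and>
    holomorphic_map (plane_mfd U \<times>\<^sub>m imag_units_mfd) (complexification_mfd \<times>\<^sub>m imag_units_mfd) FF"

definition generalized_slice_regular ::
  "complex set \<Rightarrow> ('a \<Rightarrow> 'a::{real_algebra_1, euclidean_space}) \<Rightarrow> bool"
  where "generalized_slice_regular U f \<longleftrightarrow> (\<exists>FF. regular_lift U f FF)"

definition third_class ::
  "complex set \<Rightarrow> ('a \<Rightarrow> 'a) \<Rightarrow> ('a \<Rightarrow> 'a::{real_algebra_1, euclidean_space}) \<Rightarrow> bool"
  where "third_class U \<phi> f \<longleftrightarrow>
    (\<exists>F. holomorphic_map (plane_mfd U) complexification_mfd F \<and>
         regular_lift U f (\<lambda>(z, s). (F z, \<phi> s)))"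

definition classical_slice_regular ::
  "complex set \<Rightarrow> ('a \<Rightarrow> 'a::{real_algebra_1, euclidean_space}) \<Rightarrow> bool"
  where "classical_slice_regular U f \<longleftrightarrow>
    (\<exists>F. holomorphic_map (plane_mfd U) complexification_mfd F \<and>
         (\<forall>z\<in>U. F (cnj z) = conj_cplx (F z)) \<and>
         (\<forall>z\<in>U. \<forall>s\<in>imag_units. f (slice_pt (z, s)) = slice_val (F z, s)))"

definition C1_on :: "complex set \<Rightarrow> (complex \<Rightarrow> 'a::real_normed_vector) \<Rightarrow> bool"
  where "C1_on U g \<longleftrightarrow>
    (\<exists>g' :: complex \<Rightarrow> complex \<Rightarrow>\<^sub>L 'a.
       (\<forall>z\<in>U. (g has_derivative blinfun_apply (g' z)) (at z)) \<and> continuous_on U g')"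

text \<open>
  Slice functions are \<open>C\<^sup>1\<close> when they are so in the coordinates \<open>x, y\<close> of every slice. If \<open>f\<close> has
  the form \<open>\<alpha> z + \<phi> s * \<beta> z\<close> with \<open>\<alpha>\<close> even and \<open>\<beta>\<close> odd under conjugation, this
  is the same as \<open>\<alpha>\<close> and \<open>\<beta>\<close> being \<open>C\<^sup>1\<close>, since \<open>z \<mapsto> f (slice_pt (z, s))\<close>
  determines both, and it is implied by \<open>f\<close> being \<open>C\<^sup>1\<close> on a neighbourhood of \<open>V\<close>.
\<close>

definition slice_C1 :: "complex set \<Rightarrow> ('a \<Rightarrow> 'a::{real_algebra_1, euclidean_space}) \<Rightarrow> bool"
  where "slice_C1 U f \<longleftrightarrow> (\<forall>s\<in>imag_units. C1_on U (\<lambda>z. f (slice_pt (z, s))))"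

definition slice_dx :: "('a \<Rightarrow> 'a::{real_algebra_1, euclidean_space}) \<Rightarrow> complex \<times> 'a \<Rightarrow> 'a"
  where "slice_dx f = (\<lambda>(z, s).
    vector_derivative (\<lambda>x. f (slice_pt (Complex x (Im z), s))) (at (Re z)))"

definition slice_dy :: "('a \<Rightarrow> 'a::{real_algebra_1, euclidean_space}) \<Rightarrow> complex \<times> 'a \<Rightarrow> 'a"
  where "slice_dy f = (\<lambda>(z, s).
    vector_derivative (\<lambda>y. f (slice_pt (Complex (Re z) y, s))) (at (Im z)))"

text \<open>
  The operator is a function of the coordinates \<open>(z, s)\<close> of a point \<open>a = slice_pt (z, s)\<close>. The
  only other coordinates of a nonreal \<open>a\<close> are \<open>slice_sigma (z, s)\<close>, which give the same value
  if \<open>\<phi>\<close> is odd, see \<open>slice_D_slice_sigma\<close>.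
\<close>

definition slice_D ::
  "('a \<Rightarrow> 'a) \<Rightarrow> ('a \<Rightarrow> 'a::{real_algebra_1, euclidean_space}) \<Rightarrow> complex \<times> 'a \<Rightarrow> 'a"
  where "slice_D \<phi> f p = slice_dx f p + \<phi> (snd p) * slice_dy f p"

lemma slice_pt_slice_sigma [simp]: "slice_pt (slice_sigma p) = slice_pt p"
  by (cases p) (simp add: slice_pt_def slice_sigma_def)

lemma slice_D_slice_sigma:
  fixes f :: "'a \<Rightarrow> 'a::{real_algebra_1, euclidean_space}"
  assumes odd: "\<phi> (- s) = - \<phi> s"
    and diff: "(\<lambda>z. f (slice_pt (z, s))) differentiable (at z)"
  shows "slice_D \<phi> f (slice_sigma (z, s)) = slice_D \<phi> f (z, s)"
proof -
  let ?h = "\<lambda>y. f (slice_pt (Complex (Re z) y, s))"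
  obtain L where "((\<lambda>z. f (slice_pt (z, s))) has_derivative L) (at (Complex (Re z) (Im z)))"
    using diff by (auto simp: differentiable_def)
  moreover have "(Complex (Re z) has_derivative (\<lambda>y. \<i> * of_real y)) (at (Im z))"
  proof -
    have "Complex (Re z) = (\<lambda>y. of_real (Re z) + \<i> * of_real y)"
      by (simp add: fun_eq_iff Complex_eq)
    then show ?thesis by (auto intro!: derivative_eq_intros)
  qed
  ultimately have "((\<lambda>y. f (slice_pt (Complex (Re z) y, s)))
      has_derivative (\<lambda>y. L (\<i> * of_real y))) (at (Im z))"
    by (rule has_derivative_compose[rotated])
  then have "?h differentiable (at (Im z))"
    by (auto simp: differentiable_def)
  then have d: "(?h has_vector_derivative vector_derivative ?h (at (Im z))) (at (Im z))"
    by (simp add: vector_derivative_works)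
  have "((\<lambda>y::real. - y) has_vector_derivative - 1) (at (- Im z))"
    by (auto intro!: derivative_eq_intros)
  moreover have "(?h has_vector_derivative vector_derivative ?h (at (Im z))) (at (- (- Im z)))"
    using d by simp
  ultimately have "((?h \<circ> uminus) has_vector_derivative
      (- 1) *\<^sub>R vector_derivative ?h (at (Im z))) (at (- Im z))"
    by (rule vector_diff_chain_at)
  then have "vector_derivative (\<lambda>y. ?h (- y)) (at (- Im z)) = - vector_derivative ?h (at (Im z))"
    using vector_derivative_at by (fastforce simp: o_def)
  then show ?thesis
    by (simp add: slice_D_def slice_dx_def slice_dy_def slice_sigma_def slice_pt_def odd)
qed

end

theory Submission
  imports Defs
begin

text \<open>
  Write \<open>f = \<alpha> + \<phi>(s) \<beta>\<close>. Since \<open>\<phi>(s)\<^sup>2 = - 1\<close>, the defect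
  \<open>\<partial>\<^sub>x f + \<phi>(s) \<partial>\<^sub>y f\<close> equals \<open>(\<alpha>\<^sub>x - \<beta>\<^sub>y) + \<phi>(s) (\<alpha>\<^sub>y + \<beta>\<^sub>x)\<close>, so it vanishes when
  \<open>(\<alpha>, \<beta>)\<close> satisfies the Cauchy-Riemann equations. Conversely, \<open>\<phi>\<close> is odd, so comparing the
  defects at \<open>s\<close> and \<open>- s\<close> separates the two summands and gives these equations off the real
  axis; they extend to real points because \<open>f\<close> is \<open>C\<^sup>1\<close> and nonreal points are dense.
\<close>

section \<open>Imaginary units and derivatives along a slice\<close>

text \<open>The norm is not assumed compatible with multiplication, so boundedness comes from finite
  dimension, where every bilinear map is bounded.\<close>

lemma bounded_bilinear_times_euclidean:
  "bounded_bilinear ((*) :: 'a::{real_algebra_1, euclidean_space} \<Rightarrow> 'a \<Rightarrow> 'a)"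
  unfolding bilinear_conv_bounded_bilinear[symmetric] bilinear_def
  by (auto intro!: linearI simp: algebra_simps)

lemma mult_self_imag_units: "s \<in> imag_units \<Longrightarrow> s * s = - 1"
  by (simp add: imag_units_def power2_eq_square)

lemma minus_imag_units: "s \<in> imag_units \<Longrightarrow> - s \<in> imag_units"
  by (simp add: imag_units_def)

text \<open>Otherwise \<open>s\<close> would be a real scalar whose square is negative. This turns
  nonreality of a point of V into a condition on \<open>z\<close> alone.\<close>

lemma slice_pt_in_Reals_iff:
  fixes s :: "'a::real_algebra_1"
  assumes "s \<in> imag_units"
  shows "slice_pt (z, s) \<in> \<real> \<longleftrightarrow> Im z = 0"
proof
  assume "slice_pt (z, s) \<in> \<real>"
  then obtain r where r: "of_real (Re z) + s * of_real (Im z) = of_real r"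
    by (auto simp: slice_pt_def Reals_def)
  show "Im z = 0"
  proof (rule ccontr)
    assume nz: "Im z \<noteq> 0"
    define c where "c = (r - Re z) / Im z"
    have "s * of_real (Im z) = of_real (r - Re z)"
      using r by (simp add: algebra_simps)
    then have "s * of_real (Im z) * of_real (inverse (Im z)) = of_real (r - Re z) * of_real (inverse (Im z))"
      by simp
    then have "s = of_real c"
      using nz unfolding mult.assoc of_real_mult[symmetric] by (simp add: c_def divide_inverse)
    with mult_self_imag_units[OF assms] have "of_real (c * c) = (of_real (- 1) :: 'a)"
      by simp
    then have "c * c = - 1"
      unfolding of_real_eq_iff .
    then show False
      using zero_le_square[of c] by linarith
  qed
qed (simp add: slice_pt_def)

text \<open>The chain rule along the horizontal and vertical lines through \<open>z\<close> reads
  both partial derivatives off the total differential.\<close>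

lemma slice_D_eq:
  fixes f :: "'a \<Rightarrow> 'a::{real_algebra_1, euclidean_space}"
  assumes "((\<lambda>z. f (slice_pt (z, s))) has_derivative L) (at z)"
  shows "slice_D \<phi> f (z, s) = L 1 + \<phi> s * L \<i>"
proof -
  let ?h = "\<lambda>z. f (slice_pt (z, s))"
  interpret L: bounded_linear L
    using assms by (rule has_derivative_bounded_linear)
  have h: "(?h has_derivative L) (at (Complex (Re z) (Im z)))"
    using assms by simp
  have cx: "(\<lambda>x. Complex x (Im z)) = (\<lambda>x. of_real x + \<i> * of_real (Im z))"
    and cy: "Complex (Re z) = (\<lambda>y. of_real (Re z) + \<i> * of_real y)"
    by (simp_all add: fun_eq_iff Complex_eq)
  have "((\<lambda>x. Complex x (Im z)) has_derivative (\<lambda>x. x *\<^sub>R 1)) (at (Re z))"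
    unfolding cx by (auto intro!: derivative_eq_intros simp: scaleR_conv_of_real)
  from has_derivative_compose[OF this h]
  have "((\<lambda>x. ?h (Complex x (Im z))) has_vector_derivative L 1) (at (Re z))"
    by (simp add: has_vector_derivative_def L.scaleR)
  moreover have "(Complex (Re z) has_derivative (\<lambda>y. y *\<^sub>R \<i>)) (at (Im z))"
    unfolding cy by (auto intro!: derivative_eq_intros simp: scaleR_conv_of_real)
  from has_derivative_compose[OF this h]
  have "((\<lambda>y. ?h (Complex (Re z) y)) has_vector_derivative L \<i>) (at (Im z))"
    by (simp add: has_vector_derivative_def L.scaleR)
  ultimately show ?thesis
    by (simp add: slice_D_def slice_dx_def slice_dy_def vector_derivative_at)
qed

section \<open>Holomorphic maps and product lifts\<close>

text \<open>Since \<open>1\<close> and \<open>\<i>\<close> span the plane over the reals, complex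
  linearity need only be tested at \<open>1\<close>. For F = (\<alpha>, \<beta>) the resulting
  equation is the Cauchy-Riemann system.\<close>

lemma holomorphic_map_plane_iff:
  fixes F :: "complex \<Rightarrow> 'a::real_normed_vector \<times> 'a"
  assumes "open U"
  shows "holomorphic_map (plane_mfd U) complexification_mfd F \<longleftrightarrow>
    (\<forall>z\<in>U. \<exists>L. (F has_derivative L) (at z) \<and> L \<i> = (- snd (L 1), fst (L 1)))"
proof -
  have *: "(\<forall>v. L (\<i> * v) = (case L v of (a, b) \<Rightarrow> (- b, a))) \<longleftrightarrow> L \<i> = (- snd (L 1), fst (L 1))"
    if "bounded_linear L" for L :: "complex \<Rightarrow> 'a \<times> 'a"
  proof -
    interpret L: bounded_linear L by fact
    have "L (\<i> * v) = (case L v of (a, b) \<Rightarrow> (- b, a))" if L: "L \<i> = (- snd (L 1), fst (L 1))" for v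
    proof -
      have v: "v = Re v *\<^sub>R 1 + Im v *\<^sub>R \<i>" and iv: "\<i> * v = - Im v *\<^sub>R 1 + Re v *\<^sub>R \<i>"
        by (rule complex_eqI; simp)+
      have "L v = Re v *\<^sub>R L 1 + Im v *\<^sub>R L \<i>"
        using arg_cong[OF v, of L] unfolding L.add L.scaleR .
      moreover have "L (\<i> * v) = - Im v *\<^sub>R L 1 + Re v *\<^sub>R L \<i>"
        using arg_cong[OF iv, of L] unfolding L.add L.scaleR .
      ultimately show ?thesis
        unfolding L by (simp add: case_prod_beta prod_eq_iff)
    qed
    moreover have "L \<i> = (- snd (L 1), fst (L 1))"
      if "\<forall>v. L (\<i> * v) = (case L v of (a, b) \<Rightarrow> (- b, a))"
      using that[rule_format, of 1] by (simp add: case_prod_beta)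
    ultimately show ?thesis
      by (intro iffI allI)
  qed
  have "holomorphic_map (plane_mfd U) complexification_mfd F \<longleftrightarrow>
      (\<forall>z\<in>U. \<exists>L. (F has_derivative L) (at z) \<and> (\<forall>v. L (\<i> * v) = (case L v of (a, b) \<Rightarrow> (- b, a))))"
    unfolding holomorphic_map_def plane_mfd_def complexification_mfd_def complex_mfd.simps
    using at_within_open[OF _ assms] by auto
  also have "\<dots> \<longleftrightarrow> (\<forall>z\<in>U. \<exists>L. (F has_derivative L) (at z) \<and> L \<i> = (- snd (L 1), fst (L 1)))"
    by (intro ball_cong ex_cong1 conj_cong refl) (rule *, rule has_derivative_bounded_linear)
  finally show ?thesis .
qed

text \<open>Provides the witness when \<open>imag_units\<close> is empty.\<close>

lemma holomorphic_map_plane_zero: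
  assumes "open U"
  shows "holomorphic_map (plane_mfd U) complexification_mfd (\<lambda>_. 0 :: 'a::real_normed_vector \<times> 'a)"
  unfolding holomorphic_map_plane_iff[OF assms]
  by (auto intro!: exI[of _ "\<lambda>_. 0"] has_derivative_const simp: prod_eq_iff)

lemma holomorphic_map_prod:
  assumes F: "holomorphic_map M N F" and G: "holomorphic_map M' N' G"
  shows "holomorphic_map (M \<times>\<^sub>m M') (N \<times>\<^sub>m N') (\<lambda>(p, q). (F p, G q))"
  unfolding holomorphic_map_def
proof (intro conjI ballI)
  show "(\<lambda>(p, q). (F p, G q)) ` points (M \<times>\<^sub>m M') \<subseteq> points (N \<times>\<^sub>m N')"
    using F G by (auto simp: holomorphic_map_def prod_mfd_def)
next
  fix x assume "x \<in> points (M \<times>\<^sub>m M')"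
  then obtain p q where x: "x = (p, q)" "p \<in> points M" "q \<in> points M'"
    by (auto simp: prod_mfd_def)
  obtain D E where
    D: "(F has_derivative D) (at p within points M)"
      "\<And>v. v \<in> tangent M p \<Longrightarrow> D (cstr M p v) = cstr N (F p) (D v)" and
    E: "(G has_derivative E) (at q within points M')"
      "\<And>w. w \<in> tangent M' q \<Longrightarrow> E (cstr M' q w) = cstr N' (G q) (E w)"
    using F G x unfolding holomorphic_map_def by meson
  let ?P = "points M \<times> points M'"
  \<comment> \<open>The projections are onto because \<open>p\<close> and \<open>q\<close> show both
    factors nonempty. The chain rule needs the derivatives within these images.\<close>
  have img: "fst ` ?P = points M" "snd ` ?P = points M'"
    using x by force+
  have "((\<lambda>x. F (fst x)) has_derivative (\<lambda>v. D (fst v))) (at (p, q) within ?P)"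
    using has_derivative_in_compose[OF has_derivative_fst[OF has_derivative_ident], of F D "(p, q)" ?P] D(1)
    unfolding img by simp
  moreover have "((\<lambda>x. G (snd x)) has_derivative (\<lambda>v. E (snd v))) (at (p, q) within ?P)"
    using has_derivative_in_compose[OF has_derivative_snd[OF has_derivative_ident], of G E "(p, q)" ?P] E(1)
    unfolding img by simp
  ultimately have "((\<lambda>(p, q). (F p, G q)) has_derivative (\<lambda>(v, w). (D v, E w)))
      (at x within points (M \<times>\<^sub>m M'))"
    unfolding x(1) case_prod_beta' by (simp add: prod_mfd_def has_derivative_Pair)
  moreover have "\<forall>v\<in>tangent (M \<times>\<^sub>m M') x. (case cstr (M \<times>\<^sub>m M') x v of (v, w) \<Rightarrow> (D v, E w)) =
      cstr (N \<times>\<^sub>m N') (case x of (p, q) \<Rightarrow> (F p, G q)) (case v of (v, w) \<Rightarrow> (D v, E w))"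
    using D(2) E(2) by (auto simp: x(1) prod_mfd_def)
  ultimately show "\<exists>D. ((\<lambda>(p, q). (F p, G q)) has_derivative D) (at x within points (M \<times>\<^sub>m M')) \<and>
      (\<forall>v\<in>tangent (M \<times>\<^sub>m M') x. D (cstr (M \<times>\<^sub>m M') x v) =
        cstr (N \<times>\<^sub>m N') (case x of (p, q) \<Rightarrow> (F p, G q)) (D v))"
    by blast
qed

lemma holomorphic_map_id: "holomorphic_map M M id"
  unfolding holomorphic_map_def by (auto intro!: exI[of _ "\<lambda>x. x"] simp: id_def)

text \<open>Every condition stands under both quantifiers, so an empty \<open>imag_units\<close>
  leaves \<open>F\<close> unconstrained; hence the case distinctions below.\<close>

lemma slice_lift_third_class_iff:
  "slice_lift U f (\<lambda>(z, s). (F z, \<phi> s)) \<longleftrightarrow>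
    (\<forall>z\<in>U. \<forall>s\<in>imag_units. f (slice_pt (z, s)) = fst (F z) + \<phi> s * snd (F z) \<and>
      F (cnj z) = conj_cplx (F z) \<and> \<phi> (- s) = - \<phi> s)"
  by (auto simp: slice_lift_def slice_val_def slice_sigma_def slice_tau_def case_prod_beta)

text \<open>Holomorphy of the lift follows from that of its two factors by
  \<open>holomorphic_map_prod\<close>.\<close>

lemma third_class_iff:
  assumes "holomorphic_map imag_units_mfd imag_units_mfd \<phi>"
  shows "third_class U \<phi> f \<longleftrightarrow>
    (\<exists>F. holomorphic_map (plane_mfd U) complexification_mfd F \<and>
      slice_lift U f (\<lambda>(z, s). (F z, \<phi> s)))"
  using holomorphic_map_prod[OF _ assms] unfolding third_class_def regular_lift_def by blast

lemma continuous_on_zero_off_reals: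
  fixes E :: "complex \<Rightarrow> 'a::real_normed_vector"
  assumes U: "open U" and cont: "continuous_on U E" and z: "z \<in> U"
    and zero: "\<And>z. z \<in> U \<Longrightarrow> Im z \<noteq> 0 \<Longrightarrow> E z = 0"
  shows "E z = 0"
proof (cases "Im z = 0")
  case True
  \<comment> \<open>These points lie strictly above the real point \<open>z\<close>, converge to it,
    and are eventually in the open set \<open>U\<close>.\<close>
  let ?w = "\<lambda>n. z + of_real (inverse (real (Suc n))) * \<i>"
  have "?w \<longlonglongrightarrow> z + of_real 0 * \<i>"
    by (intro tendsto_intros LIMSEQ_inverse_real_of_nat)
  then have lim: "?w \<longlonglongrightarrow> z" by simp
  have "isCont E z"
    using U cont z by (simp add: continuous_on_eq_continuous_at)
  then have "(\<lambda>n. E (?w n)) \<longlonglongrightarrow> E z"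
    using lim by (rule isCont_tendsto_compose)
  moreover have "eventually (\<lambda>n. ?w n \<in> U) sequentially"
    using lim U z by (rule topological_tendstoD)
  then have "eventually (\<lambda>n. E (?w n) = 0) sequentially"
    by eventually_elim (rule zero, use True in simp_all)
  then have "(\<lambda>n. E (?w n)) \<longlonglongrightarrow> 0"
    by (rule tendsto_eventually)
  ultimately show ?thesis
    by (rule LIMSEQ_unique)
qed (simp add: zero z)

section \<open>The differential criterion\<close>

lemma third_class_iff_slice_D:
  fixes f \<phi> :: "'a::{real_algebra_1, euclidean_space} \<Rightarrow> 'a"
  assumes U: "open U"
    and hol: "holomorphic_map imag_units_mfd imag_units_mfd \<phi>"
    and lift: "slice_lift U f (\<lambda>(z, s). ((\<alpha> z, \<beta> z), \<phi> s))"
    and C1: "slice_C1 U f"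
  shows "third_class U \<phi> f \<longleftrightarrow>
    (\<forall>z\<in>U. \<forall>s\<in>imag_units. slice_pt (z, s) \<notin> \<real> \<longrightarrow> slice_D \<phi> f (z, s) = 0)"
proof
  interpret times: bounded_bilinear "(*) :: 'a \<Rightarrow> 'a \<Rightarrow> 'a"
    by (rule bounded_bilinear_times_euclidean)
  have \<phi>: "\<phi> s \<in> imag_units" if "s \<in> imag_units" for s
    using hol that by (auto simp: holomorphic_map_def imag_units_mfd_def)
  {
    assume "third_class U \<phi> f"
    then obtain F where F: "holomorphic_map (plane_mfd U) complexification_mfd F"
      and f: "\<And>z s. z \<in> U \<Longrightarrow> s \<in> imag_units \<Longrightarrow>
        f (slice_pt (z, s)) = fst (F z) + \<phi> s * snd (F z)"
      unfolding third_class_iff[OF hol] slice_lift_third_class_iff by blast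
    have "slice_D \<phi> f (z, s) = 0" if z: "z \<in> U" and s: "s \<in> imag_units" for z s
    proof -
      obtain L where L: "(F has_derivative L) (at z)" "L \<i> = (- snd (L 1), fst (L 1))"
        using F z unfolding holomorphic_map_plane_iff[OF U] by blast
      have "((\<lambda>z. fst (F z) + \<phi> s * snd (F z)) has_derivative (\<lambda>v. fst (L v) + \<phi> s * snd (L v))) (at z)"
        by (intro has_derivative_add bounded_linear.has_derivative[OF times.bounded_linear_right]
            has_derivative_fst has_derivative_snd L(1))
      then have "((\<lambda>z. f (slice_pt (z, s))) has_derivative (\<lambda>v. fst (L v) + \<phi> s * snd (L v))) (at z)"
        by (rule has_derivative_transform_within_open[OF _ U z]) (simp add: f s)
      \<comment> \<open>After inserting \<open>L \<i>\<close>, the terms in \<open>snd (L 1)\<close>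
        cancel directly and those in \<open>fst (L 1)\<close> by
        \<open>\<phi> s * \<phi> s = - 1\<close>.\<close>
      from slice_D_eq[OF this, of \<phi>] show ?thesis
        by (simp add: L(2) algebra_simps mult_self_imag_units \<phi> s flip: mult.assoc)
    qed
    then show "\<forall>z\<in>U. \<forall>s\<in>imag_units. slice_pt (z, s) \<notin> \<real> \<longrightarrow> slice_D \<phi> f (z, s) = 0"
      by blast
  }
  assume D0: "\<forall>z\<in>U. \<forall>s\<in>imag_units. slice_pt (z, s) \<notin> \<real> \<longrightarrow> slice_D \<phi> f (z, s) = 0"
  show "third_class U \<phi> f"
  proof (cases "imag_units = ({} :: 'a set)")
    case True
    \<comment> \<open>The lift condition is vacuous here, and the given \<alpha>, \<beta> may fail
      to be holomorphic, so the zero map is taken for \<open>F\<close>.\<close>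
    then show ?thesis
      using holomorphic_map_plane_zero[OF U]
      unfolding third_class_iff[OF hol] slice_lift_def by auto
  next
    case False
    then obtain s :: 'a where s: "s \<in> imag_units" by blast
    have eq: "f (slice_pt (z, t)) = \<alpha> z + \<phi> t * \<beta> z" "\<phi> (- t) = - \<phi> t"
      if "z \<in> U" "t \<in> imag_units" for z t
      using lift that unfolding slice_lift_third_class_iff by auto
    have "\<exists>L. \<forall>z\<in>U. ((\<lambda>z. f (slice_pt (z, t))) has_derivative L z) (at z) \<and>
        L z 1 + \<phi> t * L z \<i> = 0" if t: "t \<in> imag_units" for t
    proof -
      obtain g' where g': "\<And>z. z \<in> U \<Longrightarrow>
          ((\<lambda>z. f (slice_pt (z, t))) has_derivative blinfun_apply (g' z)) (at z)"
        and cont: "continuous_on U g'"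
        using C1 t unfolding slice_C1_def C1_on_def by blast
      \<comment> \<open>The defect, written with the continuous differential \<open>g'\<close>, is
        itself continuous; its vanishing therefore passes to real points.\<close>
      let ?E = "\<lambda>z. blinfun_apply (g' z) 1 + \<phi> t * blinfun_apply (g' z) \<i>"
      have "continuous_on U ?E"
        by (intro continuous_intros bounded_linear.continuous_on[OF times.bounded_linear_right] cont)
      moreover have "?E z = 0" if "z \<in> U" "Im z \<noteq> 0" for z
        using D0 slice_D_eq[OF g', of z \<phi>] slice_pt_in_Reals_iff[OF t, of z] that t by auto
      ultimately have "?E z = 0" if "z \<in> U" for z
        using continuous_on_zero_off_reals[OF U, of ?E] that by blast
      with g' show ?thesis
        by (intro exI[of _ "\<lambda>z. blinfun_apply (g' z)"]) blast
    qed
    then obtain L where L: "\<And>t z. t \<in> imag_units \<Longrightarrow> z \<in> U \<Longrightarrow>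
        ((\<lambda>z. f (slice_pt (z, t))) has_derivative L t z) (at z)"
      and CR: "\<And>t z. t \<in> imag_units \<Longrightarrow> z \<in> U \<Longrightarrow> L t z 1 + \<phi> t * L t z \<i> = 0"
      by metis
    have \<phi>\<phi>: "\<phi> s * (\<phi> s * a) = - a" for a
      using mult_self_imag_units[OF \<phi>[OF s]] by (simp flip: mult.assoc)
    note ms = minus_imag_units[OF s]
    \<comment> \<open>These recover \<open>a\<close> and \<open>b\<close> from p = a + \<phi>(s) b
      and m = a - \<phi>(s) b, because m - p = -2 \<phi>(s) b. Thus \<alpha> and \<beta> inherit
      differentiability from the slices of \<open>s\<close> and \<open>- s\<close>.\<close>
    let ?A = "\<lambda>p m. (1 / 2) *\<^sub>R (p + m)" and ?B = "\<lambda>p m. (1 / 2) *\<^sub>R (\<phi> s * (m - p))"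
    have AB: "?A (a + \<phi> s * b) (a - \<phi> s * b) = a" "?B (a + \<phi> s * b) (a - \<phi> s * b) = b" for a b
      by (simp_all add: distrib_left right_diff_distrib \<phi>\<phi> flip: scaleR_2)
    have "\<exists>M. ((\<lambda>z. (\<alpha> z, \<beta> z)) has_derivative M) (at z) \<and> M \<i> = (- snd (M 1), fst (M 1))"
      if z: "z \<in> U" for z
    proof (intro exI conjI)
      let ?M = "\<lambda>v. (?A (L s z v) (L (- s) z v), ?B (L s z v) (L (- s) z v))"
      have "((\<lambda>z. (?A (f (slice_pt (z, s))) (f (slice_pt (z, - s))),
          ?B (f (slice_pt (z, s))) (f (slice_pt (z, - s))))) has_derivative ?M) (at z)"
        by (intro has_derivative_Pair has_derivative_scaleR_right has_derivative_add has_derivative_diff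
            bounded_linear.has_derivative[OF times.bounded_linear_right] L z s ms)
      then show "((\<lambda>z. (\<alpha> z, \<beta> z)) has_derivative ?M) (at z)"
        by (rule has_derivative_transform_within_open[OF _ U z])
          (simp only: eq s ms AB minus_mult_left[symmetric] diff_conv_add_uminus[symmetric])
      \<comment> \<open>The signs differ because \<phi> is odd. Substituting both into
        \<open>?M 1\<close> yields the Cauchy-Riemann equations for \<open>?M\<close>.\<close>
      have x: "L s z 1 = - (\<phi> s * L s z \<i>)" "L (- s) z 1 = \<phi> s * L (- s) z \<i>"
        using CR[OF s z] CR[OF ms z] by (simp_all add: eq[OF z s] add_eq_0_iff)
      show "?M \<i> = (- snd (?M 1), fst (?M 1))"
        by (simp add: x algebra_simps \<phi>\<phi>)
    qed
    then have "holomorphic_map (plane_mfd U) complexification_mfd (\<lambda>z. (\<alpha> z, \<beta> z))"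
      unfolding holomorphic_map_plane_iff[OF U] by blast
    then show ?thesis
      using lift unfolding third_class_iff[OF hol] by blast
  qed
qed

section \<open>Comparison with classical slice regularity\<close>

text \<open>The identity is holomorphic and odd, so only the symmetry of \<open>F\<close> remains,
  and any imaginary unit frees it from the quantifier over \<open>s\<close>. If there is none, the
  zero map satisfies both sides.\<close>

lemma third_class_id_iff_classical:
  fixes g :: "'a \<Rightarrow> 'a::{real_algebra_1, euclidean_space}"
  assumes "open U"
  shows "third_class U id g \<longleftrightarrow> classical_slice_regular U g"
proof (cases "imag_units = ({} :: 'a set)")
  case True
  then show ?thesis
    using holomorphic_map_plane_zero[OF assms]
    unfolding third_class_iff[OF holomorphic_map_id] slice_lift_def classical_slice_regular_def
    by (auto intro!: exI[of _ "\<lambda>_. 0"] simp: conj_cplx_def zero_prod_def)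
next
  case False
  have "slice_lift U g (\<lambda>(z, s). (F z, id s)) \<longleftrightarrow>
    (\<forall>z\<in>U. F (cnj z) = conj_cplx (F z)) \<and>
    (\<forall>z\<in>U. \<forall>s\<in>imag_units. g (slice_pt (z, s)) = slice_val (F z, s))" for F
    unfolding slice_lift_third_class_iff slice_val_def case_prod_beta fst_conv snd_conv id_apply
    using False by blast
  then show ?thesis
    unfolding third_class_iff[OF holomorphic_map_id] classical_slice_regular_def by simp
qed

theorem theorem6p10:
  fixes \<U> :: "complex set"
    and \<phi> f :: "'a::{real_algebra_1, euclidean_space} \<Rightarrow> 'a"
    and \<alpha> \<beta> :: "complex \<Rightarrow> 'a"
  assumes "compact (imag_units :: 'a set)"
    and "connected (imag_units :: 'a set)"
    and "open \<U>" and "connected \<U>"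
    and "\<And>z. z \<in> \<U> \<Longrightarrow> cnj z \<in> \<U>"
    and "\<phi> \<in> Aut_imag_units"
    and "slice_lift \<U> f (\<lambda>(z, s). ((\<alpha> z, \<beta> z), \<phi> s))"
    and "\<And>z s. z \<in> \<U> \<Longrightarrow> s \<in> imag_units \<Longrightarrow> f (slice_pt (z, s)) = \<alpha> z + \<phi> s * \<beta> z"
    and "\<And>z. z \<in> \<U> \<Longrightarrow> \<alpha> (cnj z) = \<alpha> z"
    and "\<And>z. z \<in> \<U> \<Longrightarrow> \<beta> (cnj z) = - \<beta> z"
    and "slice_C1 \<U> f"
  shows "(third_class \<U> \<phi> f \<longleftrightarrow>
      (\<forall>z\<in>\<U>. \<forall>s\<in>imag_units. slice_pt (z, s) \<notin> \<real> \<longrightarrow> slice_D \<phi> f (z, s) = 0)) \<and>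
    (\<forall>(g :: 'a \<Rightarrow> 'a) z s. slice_D id g (z, s) = slice_dx g (z, s) + s * slice_dy g (z, s)) \<and>
    (\<forall>g :: 'a \<Rightarrow> 'a. third_class \<U> id g \<longleftrightarrow> classical_slice_regular \<U> g) \<and>
    ((\<forall>s\<in>imag_units. \<phi> s = s) \<longrightarrow>
      (classical_slice_regular \<U> f \<longleftrightarrow>
        (\<forall>z\<in>\<U>. \<forall>s\<in>imag_units. slice_pt (z, s) \<notin> \<real> \<longrightarrow>
           slice_dx f (z, s) + s * slice_dy f (z, s) = 0)))"
proof (intro conjI allI impI)
  have Aut: "holomorphic_map imag_units_mfd imag_units_mfd \<phi>"
    using assms(6) by (simp add: Aut_imag_units_def)
  show "third_class \<U> \<phi> f \<longleftrightarrow>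
      (\<forall>z\<in>\<U>. \<forall>s\<in>imag_units. slice_pt (z, s) \<notin> \<real> \<longrightarrow> slice_D \<phi> f (z, s) = 0)"
    by (rule third_class_iff_slice_D[OF assms(3) Aut assms(7,11)])
  show D_id: "slice_D id g (z, s) = slice_dx g (z, s) + s * slice_dy g (z, s)" for g :: "'a \<Rightarrow> 'a" and z s
    by (simp add: slice_D_def)
  show class_id: "third_class \<U> id g \<longleftrightarrow> classical_slice_regular \<U> g" for g :: "'a \<Rightarrow> 'a"
    by (rule third_class_id_iff_classical[OF assms(3)])
  assume id: "\<forall>s\<in>imag_units. \<phi> s = s"
  \<comment> \<open>\<phi> agrees with \<open>id\<close> on \<open>imag_units\<close> but possibly
    not elsewhere, so the lift is transferred and the criterion applied afresh to
    \<open>id\<close>.\<close>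
  have "slice_lift \<U> f (\<lambda>(z, s). ((\<alpha> z, \<beta> z), id s))"
    using assms(7) id unfolding slice_lift_third_class_iff by simp
  from third_class_iff_slice_D[OF assms(3) holomorphic_map_id this assms(11)]
  show "classical_slice_regular \<U> f \<longleftrightarrow>
      (\<forall>z\<in>\<U>. \<forall>s\<in>imag_units. slice_pt (z, s) \<notin> \<real> \<longrightarrow>
         slice_dx f (z, s) + s * slice_dy f (z, s) = 0)"
    unfolding class_id D_id .
qed

end
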